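(* Let $\rho_\pi\in(0,1]$, $\sigma_\pi>0$, $r>0$, $\lambda>0$, and put $\tilde\lambda\equiv\lambda/r$. Consider the agent's information-choice problem $$\max_{0<\sigma^2_{\pi|s}\le\sigma^2_\pi}\left(-r\rho_\pi^2\,\sigma^2_{\pi|s}-\frac{\lambda}{2}\log\frac{\sigma^2_\pi}{\sigma^2_{\pi|s}}\right),$$ and define the agent's level of attention by $\gamma = 1-\sigma^2_{\pi|s}/\sigma^2_\pi$; equivalently, attention solves $$\max_{\gamma\in[0,1]}\left(-r\rho_\pi^2(1-\gamma)\sigma_\pi^2-\frac{\lambda}{2}\log\frac{1}{1-\gamma}\right),$$ with the objective equal to $-\infty$ at $\gamma=1$. Then the optimal level of attention is $$\gamma=\max\left(0,\;1-\frac{\tilde\lambda}{2\rho_\pi^2\sigma_\pi^2}\right).$$ In particular, the optimal level of attention $\gamma$ is (i) decreasing in the relative cost of information acquisition $\tilde\lambda=\lambda/r$, (ii) increasing in inflation volatility $\sigma_\pi$, and (iii) increasing in inflation persistence $\rho_\pi$; monotonicity is understood as weak in general and strict where $\gamma>0$.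
   Context: The agent believes that demeaned inflation tomorrow is $\pi'=\rho_\pi\pi+\nu$, where $\pi$ is demeaned inflation today, $\rho_\pi$ is the perceived persistence and $\nu\sim N(0,\sigma_\nu^2)$ is i.i.d. Current inflation $\pi$ is unobserved, with Gaussian prior $\pi\sim N(\hat\pi,\sigma_\pi^2)$. The agent chooses a signal $s=\pi+\varepsilon$, $\varepsilon\sim N(0,\sigma_\varepsilon^2)$ independent of $\pi$, and forecasts $\pi^e=\rho_\pi E[\pi|s]$. The posterior variance of $\pi$ given $s$ is $\sigma^2_{\pi|s}$. The loss from forecast errors is quadratic, $-r(\rho_\pi\pi-\pi^e)^2$, where $r$ measures the stakes, so its expectation is $-r\rho_\pi^2\sigma^2_{\pi|s}$. The cost of information is $\lambda$ times the mutual information between $\pi$ and the forecast, which in this Gaussian setting equals $\frac{\lambda}{2}\log(\sigma^2_\pi/\sigma^2_{\pi|s})$. The attention level $\gamma=1-\sigma^2_{\pi|s}/\sigma_\pi^2=\sigma^2_\pi/(\sigma^2_\pi+\sigma^2_\varepsilon)$ is the weight placed on the signal in Bayesian updating: $\pi^e=\rho_\pi(1-\gamma)\hat\pi+\rho_\pi\gamma s$. *)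

theory Defs
  imports Complex_Main "HOL-Library.Extended_Real"
begin

text \<open>
  Parameters: \<open>r\<close> is the stakes, \<open>lam\<close> the marginal cost of information, \<open>\<rho>\<close> the perceived
  persistence and \<open>\<sigma>\<close> the prior standard deviation of inflation. Logarithms are natural.
\<close>

definition info_objective :: "real \<Rightarrow> real \<Rightarrow> real \<Rightarrow> real \<Rightarrow> real \<Rightarrow> real" where
  "info_objective r lam \<rho> \<sigma> v = - r * \<rho>\<^sup>2 * v - lam / 2 * ln (\<sigma>\<^sup>2 / v)"

definition optimal_posterior_variance :: "real \<Rightarrow> real \<Rightarrow> real \<Rightarrow> real \<Rightarrow> real \<Rightarrow> bool" where
  "optimal_posterior_variance r lam \<rho> \<sigma> v \<longleftrightarrow>
     is_arg_max (info_objective r lam \<rho> \<sigma>) (\<lambda>v. 0 < v \<and> v \<le> \<sigma>\<^sup>2) v"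

text \<open>
  Optimality is kept as a predicate on attention levels, so that existence and uniqueness
  of the optimum are claims to be proved rather than built into a choice operator.
\<close>

definition optimal_attention :: "real \<Rightarrow> real \<Rightarrow> real \<Rightarrow> real \<Rightarrow> real \<Rightarrow> bool" where
  "optimal_attention r lam \<rho> \<sigma> \<gamma> \<longleftrightarrow>
     (\<exists>v. optimal_posterior_variance r lam \<rho> \<sigma> v \<and> \<gamma> = 1 - v / \<sigma>\<^sup>2)"

text \<open>
  The extended reals are needed because full attention has infinite information cost; in
  \<^typ>\<open>real\<close> the totalised \<open>ln (1 / 0)\<close> would wrongly make it free.
\<close>

definition attention_objective :: "real \<Rightarrow> real \<Rightarrow> real \<Rightarrow> real \<Rightarrow> real \<Rightarrow> ereal" where
  "attention_objective r lam \<rho> \<sigma> \<gamma> =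
     (if \<gamma> = 1 then - \<infinity>
      else ereal (- r * \<rho>\<^sup>2 * (1 - \<gamma>) * \<sigma>\<^sup>2 - lam / 2 * ln (1 / (1 - \<gamma>))))"

end

(*
  With a = r * rho^2, the objective in the posterior variance v is
  -a v + (lam / 2) ln v plus a constant. At m = min (sigma^2) (lam / (2 a)) we have
  lam / (2 m) >= a, with equality unless m = sigma^2. Since ln (v / m) < v / m - 1 for v \<noteq> m,
  the objective at v exceeds its value at m by less than (v - m) (lam / (2 m) - a), which
  is <= 0 for v <= sigma^2. So m is the unique maximiser, and the
  substitution v = (1 - gamma) sigma^2 carries this over to attention levels.
*)

theory Submission
  imports Defs
begin

text \<open>Strict dominance by \<open>m\<close> yields existence and uniqueness of the maximiser at
  once. The codomain is any partial order, so that both the real objective in the variance and the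
  \<open>ereal\<close> objective in attention are covered.\<close>

lemma is_arg_max_unique_iff:
  fixes f :: "'a \<Rightarrow> 'b::order"
  assumes "P m" and "\<And>y. P y \<Longrightarrow> y \<noteq> m \<Longrightarrow> f y < f m"
  shows "is_arg_max f P x \<longleftrightarrow> x = m"
  using assms unfolding is_arg_max_def by (metis less_asym less_irrefl)

lemma ln_less_minus_one:
  fixes x :: real
  assumes "0 < x" "x \<noteq> 1"
  shows "ln x < x - 1"
  using assms ln_le_minus_one[of x] ln_eq_minus_one[of x] by fastforce

text \<open>The stationary point of the concave objective, capped at the prior variance; the cap
  binds when information is too costly to acquire.\<close>

definition best_variance :: "real \<Rightarrow> real \<Rightarrow> real \<Rightarrow> real \<Rightarrow> real" where
  "best_variance r lam \<rho> \<sigma> = min (\<sigma>\<^sup>2) (lam / (2 * r * \<rho>\<^sup>2))"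

context
  fixes r lam \<rho> \<sigma> :: real
  assumes pos: "0 < \<rho>" "0 < \<sigma>" "0 < r" "0 < lam"
begin

lemma best_variance_pos: "0 < best_variance r lam \<rho> \<sigma>"
  using pos by (simp add: best_variance_def)

lemma best_variance_le: "best_variance r lam \<rho> \<sigma> \<le> \<sigma>\<^sup>2"
  by (simp add: best_variance_def)

lemma info_objective_less_best:
  assumes v: "0 < v" "v \<le> \<sigma>\<^sup>2" and neq: "v \<noteq> best_variance r lam \<rho> \<sigma>"
  shows "info_objective r lam \<rho> \<sigma> v < info_objective r lam \<rho> \<sigma> (best_variance r lam \<rho> \<sigma>)"
proof -
  define m where "m = best_variance r lam \<rho> \<sigma>"
  have m: "0 < m" using best_variance_pos by (simp add: m_def)
  have a: "0 < r * \<rho>\<^sup>2" using pos by simp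
  \<comment> \<open>First-order condition: the second factor is the derivative of the objective at
    \<open>m\<close>. At the corner it is nonnegative while \<open>v\<close> lies to the left of
    \<open>m\<close>; at an interior \<open>m\<close> it vanishes.\<close>
  have slope: "(v - m) * (lam / (2 * m) - r * \<rho>\<^sup>2) \<le> 0"
  proof (cases "\<sigma>\<^sup>2 \<le> lam / (2 * r * \<rho>\<^sup>2)")
    case True
    then have "m = \<sigma>\<^sup>2" by (simp add: m_def best_variance_def)
    moreover from this True a m have "r * \<rho>\<^sup>2 \<le> lam / (2 * m)"
      by (simp add: field_simps)
    ultimately show ?thesis
      using v by (intro mult_nonpos_nonneg) auto
  next
    case False
    then have "m = lam / (2 * r * \<rho>\<^sup>2)" by (simp add: m_def best_variance_def)
    with a pos have "lam = (2 * m) * (r * \<rho>\<^sup>2)" by (simp add: field_simps)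
    with m have "lam / (2 * m) = r * \<rho>\<^sup>2" by simp
    then show ?thesis by simp
  qed
  \<comment> \<open>The tangent bound for ln at 1 is strict because \<open>v\<close> differs from
    \<open>m\<close>; uniqueness comes from here.\<close>
  have "ln (v / m) < v / m - 1"
    using v m neq by (intro ln_less_minus_one) (auto simp: m_def)
  then have "lam / 2 * ln (v / m) < lam / 2 * (v / m - 1)"
    using pos by simp
  moreover have "lam / 2 * (v / m - 1) - r * \<rho>\<^sup>2 * (v - m)
      = (v - m) * (lam / (2 * m) - r * \<rho>\<^sup>2)"
    using m by (simp add: field_simps)
  moreover have "info_objective r lam \<rho> \<sigma> v - info_objective r lam \<rho> \<sigma> m
      = lam / 2 * ln (v / m) - r * \<rho>\<^sup>2 * (v - m)"
    using v m pos by (simp add: info_objective_def ln_div field_simps)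
  ultimately show ?thesis
    using slope unfolding m_def[symmetric] by linarith
qed

lemma optimal_posterior_variance_iff:
  "optimal_posterior_variance r lam \<rho> \<sigma> v \<longleftrightarrow> v = best_variance r lam \<rho> \<sigma>"
  unfolding optimal_posterior_variance_def
  using best_variance_pos best_variance_le info_objective_less_best
  by (intro is_arg_max_unique_iff) auto

lemma optimal_attention_iff_best_variance:
  "optimal_attention r lam \<rho> \<sigma> \<gamma> \<longleftrightarrow> \<gamma> = 1 - best_variance r lam \<rho> \<sigma> / \<sigma>\<^sup>2"
  by (simp add: optimal_attention_def optimal_posterior_variance_iff)

text \<open>Division by \<open>\<sigma>\<^sup>2\<close> turns the cap at the prior variance into a
  cap at 1, and subtracting from 1 turns that into the floor at 0.\<close>

lemma optimal_attention_iff: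
  "optimal_attention r lam \<rho> \<sigma> \<gamma> \<longleftrightarrow> \<gamma> = max 0 (1 - (lam / r) / (2 * \<rho>\<^sup>2 * \<sigma>\<^sup>2))"
proof -
  have "best_variance r lam \<rho> \<sigma> / \<sigma>\<^sup>2 = min 1 ((lam / r) / (2 * \<rho>\<^sup>2 * \<sigma>\<^sup>2))"
    using pos by (auto simp: best_variance_def min_def field_simps)
  then show ?thesis
    by (auto simp: optimal_attention_iff_best_variance min_def max_def)
qed

text \<open>Full attention is excluded: it corresponds to variance 0, where the real-valued
  objective is finite by totalised division while the attention objective is
  \<open>- \<infinity>\<close>.\<close>

lemma attention_objective_eq_info_objective:
  assumes "\<gamma> \<noteq> 1"
  shows "attention_objective r lam \<rho> \<sigma> \<gamma> = ereal (info_objective r lam \<rho> \<sigma> ((1 - \<gamma>) * \<sigma>\<^sup>2))"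
  using assms pos by (simp add: attention_objective_def info_objective_def mult.assoc)

text \<open>The map from \<open>\<gamma>\<close> to \<open>(1 - \<gamma>) * \<sigma>\<^sup>2\<close>
  is a bijection from [0,1) onto the feasible variances, so strict dominance carries over; the
  remaining point 1 has value \<open>- \<infinity>\<close>.\<close>

lemma is_arg_max_attention_objective_iff:
  "is_arg_max (attention_objective r lam \<rho> \<sigma>) (\<lambda>\<gamma>. 0 \<le> \<gamma> \<and> \<gamma> \<le> 1) \<gamma>
    \<longleftrightarrow> \<gamma> = 1 - best_variance r lam \<rho> \<sigma> / \<sigma>\<^sup>2"
proof (rule is_arg_max_unique_iff)
  let ?m = "best_variance r lam \<rho> \<sigma>"
  let ?g = "1 - ?m / \<sigma>\<^sup>2"
  show "0 \<le> ?g \<and> ?g \<le> 1"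
    using best_variance_pos best_variance_le pos by simp
  fix y assume y: "0 \<le> y \<and> y \<le> 1" "y \<noteq> ?g"
  \<comment> \<open>Positivity of the best variance keeps \<open>?g\<close> away from 1, so its
    value is finite.\<close>
  have g: "attention_objective r lam \<rho> \<sigma> ?g = ereal (info_objective r lam \<rho> \<sigma> ?m)"
    using best_variance_pos pos by (subst attention_objective_eq_info_objective) auto
  show "attention_objective r lam \<rho> \<sigma> y < attention_objective r lam \<rho> \<sigma> ?g"
  proof (cases "y = 1")
    case True
    then show ?thesis unfolding g by (simp add: attention_objective_def)
  next
    case False
    have "(1 - y) * \<sigma>\<^sup>2 \<noteq> ?m"
      using y pos by (auto simp: field_simps)
    moreover have "0 < (1 - y) * \<sigma>\<^sup>2" "(1 - y) * \<sigma>\<^sup>2 \<le> \<sigma>\<^sup>2"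
      using y False pos by (auto simp: mult_le_cancel_right1)
    ultimately show ?thesis
      unfolding g attention_objective_eq_info_objective[OF False]
      using info_objective_less_best by simp
  qed
qed

end

text \<open>Common core of the three comparative statics: a positive truncated value is
  \<open>1 - c\<close> itself, which exceeds both 0 and \<open>1 - d\<close>.\<close>

lemma max_0_diff_strict_antimono:
  fixes c d :: real
  assumes "c < d"
  shows "max 0 (1 - d) \<le> max 0 (1 - c) \<and> (0 < max 0 (1 - c) \<longrightarrow> max 0 (1 - d) < max 0 (1 - c))"
  using assms by auto

theorem lemma1:
  fixes r lam \<rho> \<sigma> :: real
  assumes "0 < \<rho>" "\<rho> \<le> 1" "0 < \<sigma>" "0 < r" "0 < lam"
  shows
    "(\<forall>\<gamma>. optimal_attention r lam \<rho> \<sigma> \<gamma> \<longleftrightarrow>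
          is_arg_max (attention_objective r lam \<rho> \<sigma>) (\<lambda>\<gamma>. 0 \<le> \<gamma> \<and> \<gamma> \<le> 1) \<gamma>) \<and>
     (\<forall>\<gamma>. optimal_attention r lam \<rho> \<sigma> \<gamma> \<longleftrightarrow>
          \<gamma> = max 0 (1 - (lam / r) / (2 * \<rho>\<^sup>2 * \<sigma>\<^sup>2))) \<and>
     (\<forall>r' lam' \<gamma> \<gamma>'. 0 < r' \<longrightarrow> 0 < lam' \<longrightarrow> lam / r < lam' / r' \<longrightarrow>
          optimal_attention r lam \<rho> \<sigma> \<gamma> \<longrightarrow> optimal_attention r' lam' \<rho> \<sigma> \<gamma>' \<longrightarrow>
          \<gamma>' \<le> \<gamma> \<and> (0 < \<gamma> \<longrightarrow> \<gamma>' < \<gamma>)) \<and>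
     (\<forall>\<sigma>' \<gamma> \<gamma>'. \<sigma> < \<sigma>' \<longrightarrow>
          optimal_attention r lam \<rho> \<sigma> \<gamma> \<longrightarrow> optimal_attention r lam \<rho> \<sigma>' \<gamma>' \<longrightarrow>
          \<gamma> \<le> \<gamma>' \<and> (0 < \<gamma>' \<longrightarrow> \<gamma> < \<gamma>')) \<and>
     (\<forall>\<rho>' \<gamma> \<gamma>'. \<rho> < \<rho>' \<longrightarrow> \<rho>' \<le> 1 \<longrightarrow>
          optimal_attention r lam \<rho> \<sigma> \<gamma> \<longrightarrow> optimal_attention r lam \<rho>' \<sigma> \<gamma>' \<longrightarrow>
          \<gamma> \<le> \<gamma>' \<and> (0 < \<gamma>' \<longrightarrow> \<gamma> < \<gamma>'))"
\<comment> \<open>Restricting \<open>conjI\<close> to a universally quantified left conjunct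
  separates the five claims but keeps each weak-and-strict conclusion in one piece.\<close>
proof (intro conjI[of "All P" for P :: "real \<Rightarrow> bool"] allI impI)
  fix \<gamma>
  show "optimal_attention r lam \<rho> \<sigma> \<gamma> \<longleftrightarrow>
      is_arg_max (attention_objective r lam \<rho> \<sigma>) (\<lambda>\<gamma>. 0 \<le> \<gamma> \<and> \<gamma> \<le> 1) \<gamma>"
    using assms
    by (simp add: optimal_attention_iff_best_variance is_arg_max_attention_objective_iff)
next
  fix \<gamma>
  show "optimal_attention r lam \<rho> \<sigma> \<gamma> \<longleftrightarrow>
      \<gamma> = max 0 (1 - (lam / r) / (2 * \<rho>\<^sup>2 * \<sigma>\<^sup>2))"
    using assms by (intro optimal_attention_iff)
next
  fix r' lam' \<gamma> \<gamma>'
  assume h: "0 < r'" "0 < lam'" "lam / r < lam' / r'"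
    "optimal_attention r lam \<rho> \<sigma> \<gamma>" "optimal_attention r' lam' \<rho> \<sigma> \<gamma>'"
  have "(lam / r) / (2 * \<rho>\<^sup>2 * \<sigma>\<^sup>2) < (lam' / r') / (2 * \<rho>\<^sup>2 * \<sigma>\<^sup>2)"
    using h(3) assms by (intro divide_strict_right_mono) auto
  from max_0_diff_strict_antimono[OF this] h assms
  show "\<gamma>' \<le> \<gamma> \<and> (0 < \<gamma> \<longrightarrow> \<gamma>' < \<gamma>)"
    by (metis optimal_attention_iff)
next
  fix \<sigma>' \<gamma> \<gamma>'
  assume h: "\<sigma> < \<sigma>'"
    "optimal_attention r lam \<rho> \<sigma> \<gamma>" "optimal_attention r lam \<rho> \<sigma>' \<gamma>'"
  have "0 < \<sigma>'" using h assms by simp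
  have "\<sigma>\<^sup>2 < \<sigma>'\<^sup>2" using h assms by (intro power_strict_mono) auto
  \<comment> \<open>Volatility enters the denominator, so the primed ratio is now the smaller one
    and strictness hinges on \<open>0 < \<gamma>'\<close>; persistence behaves alike.\<close>
  then have "(lam / r) / (2 * \<rho>\<^sup>2 * \<sigma>'\<^sup>2) < (lam / r) / (2 * \<rho>\<^sup>2 * \<sigma>\<^sup>2)"
    using assms \<open>0 < \<sigma>'\<close> by (intro divide_strict_left_mono) auto
  from max_0_diff_strict_antimono[OF this] h assms \<open>0 < \<sigma>'\<close>
  show "\<gamma> \<le> \<gamma>' \<and> (0 < \<gamma>' \<longrightarrow> \<gamma> < \<gamma>')"
    by (metis optimal_attention_iff)
next
  fix \<rho>' \<gamma> \<gamma>'
  assume h: "\<rho> < \<rho>'"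
    "optimal_attention r lam \<rho> \<sigma> \<gamma>" "optimal_attention r lam \<rho>' \<sigma> \<gamma>'"
  have "0 < \<rho>'" using h assms by simp
  have "\<rho>\<^sup>2 < \<rho>'\<^sup>2" using h assms by (intro power_strict_mono) auto
  then have "(lam / r) / (2 * \<rho>'\<^sup>2 * \<sigma>\<^sup>2) < (lam / r) / (2 * \<rho>\<^sup>2 * \<sigma>\<^sup>2)"
    using assms \<open>0 < \<rho>'\<close> by (intro divide_strict_left_mono) auto
  from max_0_diff_strict_antimono[OF this] h assms \<open>0 < \<rho>'\<close>
  show "\<gamma> \<le> \<gamma>' \<and> (0 < \<gamma>' \<longrightarrow> \<gamma> < \<gamma>')"
    by (metis optimal_attention_iff)
qed

end
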